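(* Let $C$ be a strict $C^*$-tensor category and let $(X,m,\iota)$ be a $C^*$-Frobenius algebra in $C$. Then $T:=m^*m\in\mathrm{Hom}_C(X\otimes X,X\otimes X)$ is crossing symmetric with respect to $\mathrm{ev}_X:=\iota^*m$ and $\mathrm{coev}_X:=m^*\iota$, namely it fulfills $$\mathrm{CatCr}_X(T)=T^*=T.$$
   Context: $C$ has simple tensor unit $\mathrm{id}$, tensor multiplication $\otimes$, and the adjoint of a morphism $t$ is $t^*$; $1_X$ is the identity morphism of $X$. A $C^*$-Frobenius algebra in $C$ is a triple $(X,m,\iota)$ with $X$ an object and morphisms $m:X\otimes X\to X$, $\iota:\mathrm{id}\to X$ satisfying associativity $m(m\otimes1_X)=m(1_X\otimes m)$; unitality $m(\iota\otimes1_X)=1_X=m(1_X\otimes\iota)$; the $C^*$-Frobenius property $(m\otimes1_X)(1_X\otimes m^* )=m^*m=(1_X\otimes m)(m^*\otimes1_X)$. The morphisms $\mathrm{ev}_X:=\iota^*m:X\otimes X\to\mathrm{id}$ and $\mathrm{coev}_X:=m^*\iota=\mathrm{ev}_X^*:\mathrm{id}\to X\otimes X$ solve the conjugate equations $(1_X\otimes\mathrm{ev}_X)(\mathrm{coev}_X\otimes1_X)=1_X=(\mathrm{ev}_X\otimes1_X)(1_X\otimes\mathrm{coev}_X)$. The categorical crossing map is defined on $\mathrm{Hom}_C(X\otimes X,X\otimes X)$ by $$\mathrm{CatCr}_X(T):=(1_{X\otimes X}\otimes\mathrm{ev}_X)(1_X\otimes T\otimes1_X)(\mathrm{coev}_X\otimes1_{X\otimes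 X}),$$ and $T$ is called crossing symmetric if $\mathrm{CatCr}_X(T)=T^*$. *)

theory Defs
  imports "HOL-Analysis.Analysis"
begin

text \<open>
  A C*-tensor category is a record with explicit carriers. Every arrow has a unique domain and
  codomain, so only the zero arrow has to be indexed by a pair of objects. \<open>g \<cdot> f\<close> means
  first \<open>f\<close>, then \<open>g\<close>. The values of the operations outside
  of the objects, the arrows and the composable (resp. parallel) pairs are irrelevant.
\<close>

record ('o, 'm) tensor_cat =
  obj :: "'o set"
  arr :: "'m set"
  dom :: "'m \<Rightarrow> 'o"
  cod :: "'m \<Rightarrow> 'o"
  idt :: "'o \<Rightarrow> 'm" ("\<one>\<index>")
  comp :: "'m \<Rightarrow> 'm \<Rightarrow> 'm" (infixl "\<cdot>\<index>" 70)
  zeroarr :: "'o \<Rightarrow> 'o \<Rightarrow> 'm" ("\<zero>\<index>")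
  plusarr :: "'m \<Rightarrow> 'm \<Rightarrow> 'm" (infixl "\<oplus>\<index>" 65)
  scalearr :: "complex \<Rightarrow> 'm \<Rightarrow> 'm" (infixr "\<odot>\<index>" 75)
  normarr :: "'m \<Rightarrow> real"
  adj :: "'m \<Rightarrow> 'm" ("(_\<^sup>\<dagger>\<index>)" [1000] 999)
  unit_obj :: "'o" ("\<I>\<index>")
  tens_obj :: "'o \<Rightarrow> 'o \<Rightarrow> 'o" (infixl "\<boxtimes>\<index>" 80)
  tens :: "'m \<Rightarrow> 'm \<Rightarrow> 'm" (infixl "\<otimes>\<index>" 80)

definition hom :: "('o, 'm, 'z) tensor_cat_scheme \<Rightarrow> 'o \<Rightarrow> 'o \<Rightarrow> 'm set" where
  "hom C X Y = {f \<in> arr C. dom C f = X \<and> cod C f = Y}"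

locale complex_banach_space =
  fixes V :: "'m set" and zero :: 'm and add :: "'m \<Rightarrow> 'm \<Rightarrow> 'm"
    and scale :: "complex \<Rightarrow> 'm \<Rightarrow> 'm" and nrm :: "'m \<Rightarrow> real"
  assumes zero_closed: "zero \<in> V"
    and add_closed: "\<lbrakk>x \<in> V; y \<in> V\<rbrakk> \<Longrightarrow> add x y \<in> V"
    and scale_closed: "x \<in> V \<Longrightarrow> scale a x \<in> V"
    and add_assoc: "\<lbrakk>x \<in> V; y \<in> V; z \<in> V\<rbrakk> \<Longrightarrow> add (add x y) z = add x (add y z)"
    and add_commute: "\<lbrakk>x \<in> V; y \<in> V\<rbrakk> \<Longrightarrow> add x y = add y x"
    and add_zero: "x \<in> V \<Longrightarrow> add x zero = x"
    and add_neg: "x \<in> V \<Longrightarrow> add x (scale (- 1) x) = zero"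
    and scale_add_right: "\<lbrakk>x \<in> V; y \<in> V\<rbrakk> \<Longrightarrow> scale a (add x y) = add (scale a x) (scale a y)"
    and scale_add_left: "x \<in> V \<Longrightarrow> scale (a + b) x = add (scale a x) (scale b x)"
    and scale_scale: "x \<in> V \<Longrightarrow> scale a (scale b x) = scale (a * b) x"
    and scale_one: "x \<in> V \<Longrightarrow> scale 1 x = x"
    and norm_nonneg: "x \<in> V \<Longrightarrow> 0 \<le> nrm x"
    and norm_eq_zero: "x \<in> V \<Longrightarrow> nrm x = 0 \<longleftrightarrow> x = zero"
    and norm_triangle: "\<lbrakk>x \<in> V; y \<in> V\<rbrakk> \<Longrightarrow> nrm (add x y) \<le> nrm x + nrm y"
    and norm_scale: "x \<in> V \<Longrightarrow> nrm (scale a x) = cmod a * nrm x"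
    and complete: "Metric_space.mcomplete V (\<lambda>x y. nrm (add x (scale (- 1) y)))"

locale tensor_cat_category =
  fixes C :: "('o, 'm, 'z) tensor_cat_scheme" (structure)
  assumes dom_obj: "f \<in> arr C \<Longrightarrow> dom C f \<in> obj C"
    and cod_obj: "f \<in> arr C \<Longrightarrow> cod C f \<in> obj C"
    and id_hom: "X \<in> obj C \<Longrightarrow> \<one> X \<in> hom C X X"
    and comp_hom: "\<lbrakk>f \<in> hom C X Y; g \<in> hom C Y Z\<rbrakk> \<Longrightarrow> g \<cdot> f \<in> hom C X Z"
    and comp_assoc:
      "\<lbrakk>f \<in> hom C W X; g \<in> hom C X Y; h \<in> hom C Y Z\<rbrakk> \<Longrightarrow> (h \<cdot> g) \<cdot> f = h \<cdot> (g \<cdot> f)"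
    and comp_id_right: "f \<in> hom C X Y \<Longrightarrow> f \<cdot> \<one> X = f"
    and comp_id_left: "f \<in> hom C X Y \<Longrightarrow> \<one> Y \<cdot> f = f"

text \<open>
  The last axiom says that \<open>f\<^sup>\<dagger> \<cdot> f\<close> is a positive element of the C*-algebra of endomorphisms of
  \<open>X\<close>; for \<open>X \<noteq> Y\<close> this does not follow from the C*-identity.
\<close>

locale Cstar_category = tensor_cat_category C for C :: "('o, 'm, 'z) tensor_cat_scheme" (structure) +
  assumes hom_banach: "\<lbrakk>X \<in> obj C; Y \<in> obj C\<rbrakk> \<Longrightarrow>
      complex_banach_space (hom C X Y) (\<zero> X Y) (plusarr C) (scalearr C) (normarr C)"
    and comp_add_right: "\<lbrakk>f \<in> hom C X Y; f' \<in> hom C X Y; g \<in> hom C Y Z\<rbrakk> \<Longrightarrow>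
      g \<cdot> (f \<oplus> f') = g \<cdot> f \<oplus> g \<cdot> f'"
    and comp_add_left: "\<lbrakk>f \<in> hom C X Y; g \<in> hom C Y Z; g' \<in> hom C Y Z\<rbrakk> \<Longrightarrow>
      (g \<oplus> g') \<cdot> f = g \<cdot> f \<oplus> g' \<cdot> f"
    and comp_scale_right: "\<lbrakk>f \<in> hom C X Y; g \<in> hom C Y Z\<rbrakk> \<Longrightarrow> g \<cdot> (a \<odot> f) = a \<odot> (g \<cdot> f)"
    and comp_scale_left: "\<lbrakk>f \<in> hom C X Y; g \<in> hom C Y Z\<rbrakk> \<Longrightarrow> (a \<odot> g) \<cdot> f = a \<odot> (g \<cdot> f)"
    and norm_comp: "\<lbrakk>f \<in> hom C X Y; g \<in> hom C Y Z\<rbrakk> \<Longrightarrow>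
      normarr C (g \<cdot> f) \<le> normarr C g * normarr C f"
    and adj_hom: "f \<in> hom C X Y \<Longrightarrow> f\<^sup>\<dagger> \<in> hom C Y X"
    and adj_adj: "f \<in> hom C X Y \<Longrightarrow> (f\<^sup>\<dagger>)\<^sup>\<dagger> = f"
    and adj_comp: "\<lbrakk>f \<in> hom C X Y; g \<in> hom C Y Z\<rbrakk> \<Longrightarrow> (g \<cdot> f)\<^sup>\<dagger> = f\<^sup>\<dagger> \<cdot> g\<^sup>\<dagger>"
    and adj_add: "\<lbrakk>f \<in> hom C X Y; g \<in> hom C X Y\<rbrakk> \<Longrightarrow> (f \<oplus> g)\<^sup>\<dagger> = f\<^sup>\<dagger> \<oplus> g\<^sup>\<dagger>"
    and adj_scale: "f \<in> hom C X Y \<Longrightarrow> (a \<odot> f)\<^sup>\<dagger> = cnj a \<odot> f\<^sup>\<dagger>"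
    and Cstar_identity: "f \<in> hom C X Y \<Longrightarrow> normarr C (f\<^sup>\<dagger> \<cdot> f) = (normarr C f)\<^sup>2"
    and adj_comp_self_positive: "f \<in> hom C X Y \<Longrightarrow> \<exists>s \<in> hom C X X. f\<^sup>\<dagger> \<cdot> f = s\<^sup>\<dagger> \<cdot> s"

locale strict_Cstar_tensor_category =
  Cstar_category C for C :: "('o, 'm, 'z) tensor_cat_scheme" (structure) +
  assumes unit_obj: "\<I> \<in> obj C"
    and tens_obj: "\<lbrakk>X \<in> obj C; Y \<in> obj C\<rbrakk> \<Longrightarrow> X \<boxtimes> Y \<in> obj C"
    and tens_hom: "\<lbrakk>f \<in> hom C X Y; g \<in> hom C X' Y'\<rbrakk> \<Longrightarrow> f \<otimes> g \<in> hom C (X \<boxtimes> X') (Y \<boxtimes> Y')"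
    and tens_id: "\<lbrakk>X \<in> obj C; Y \<in> obj C\<rbrakk> \<Longrightarrow> \<one> X \<otimes> \<one> Y = \<one> (X \<boxtimes> Y)"
    and tens_comp: "\<lbrakk>f \<in> hom C X Y; g \<in> hom C Y Z; f' \<in> hom C X' Y'; g' \<in> hom C Y' Z'\<rbrakk> \<Longrightarrow>
      (g \<cdot> f) \<otimes> (g' \<cdot> f') = (g \<otimes> g') \<cdot> (f \<otimes> f')"
    and tens_add_right: "\<lbrakk>f \<in> hom C X Y; g \<in> hom C X' Y'; g' \<in> hom C X' Y'\<rbrakk> \<Longrightarrow>
      f \<otimes> (g \<oplus> g') = f \<otimes> g \<oplus> f \<otimes> g'"
    and tens_add_left: "\<lbrakk>f \<in> hom C X Y; f' \<in> hom C X Y; g \<in> hom C X' Y'\<rbrakk> \<Longrightarrow>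
      (f \<oplus> f') \<otimes> g = f \<otimes> g \<oplus> f' \<otimes> g"
    and tens_scale_right: "\<lbrakk>f \<in> hom C X Y; g \<in> hom C X' Y'\<rbrakk> \<Longrightarrow> f \<otimes> (a \<odot> g) = a \<odot> (f \<otimes> g)"
    and tens_scale_left: "\<lbrakk>f \<in> hom C X Y; g \<in> hom C X' Y'\<rbrakk> \<Longrightarrow> (a \<odot> f) \<otimes> g = a \<odot> (f \<otimes> g)"
    and tens_adj: "\<lbrakk>f \<in> hom C X Y; g \<in> hom C X' Y'\<rbrakk> \<Longrightarrow> (f \<otimes> g)\<^sup>\<dagger> = f\<^sup>\<dagger> \<otimes> g\<^sup>\<dagger>"
    and tens_obj_assoc:
      "\<lbrakk>X \<in> obj C; Y \<in> obj C; Z \<in> obj C\<rbrakk> \<Longrightarrow> (X \<boxtimes> Y) \<boxtimes> Z = X \<boxtimes> (Y \<boxtimes> Z)"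
    and tens_assoc:
      "\<lbrakk>f \<in> hom C X X'; g \<in> hom C Y Y'; h \<in> hom C Z Z'\<rbrakk> \<Longrightarrow> (f \<otimes> g) \<otimes> h = f \<otimes> (g \<otimes> h)"
    and tens_obj_unit_left: "X \<in> obj C \<Longrightarrow> \<I> \<boxtimes> X = X"
    and tens_obj_unit_right: "X \<in> obj C \<Longrightarrow> X \<boxtimes> \<I> = X"
    and tens_unit_left: "f \<in> hom C X Y \<Longrightarrow> \<one> \<I> \<otimes> f = f"
    and tens_unit_right: "f \<in> hom C X Y \<Longrightarrow> f \<otimes> \<one> \<I> = f"

definition simple_unit :: "('o, 'm, 'z) tensor_cat_scheme \<Rightarrow> bool" where
  "simple_unit C \<longleftrightarrow>
     \<one>\<^bsub>C\<^esub> \<I>\<^bsub>C\<^esub> \<noteq> \<zero>\<^bsub>C\<^esub> \<I>\<^bsub>C\<^esub> \<I>\<^bsub>C\<^esub> \<and>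
     hom C \<I>\<^bsub>C\<^esub> \<I>\<^bsub>C\<^esub> = {a \<odot>\<^bsub>C\<^esub> \<one>\<^bsub>C\<^esub> \<I>\<^bsub>C\<^esub> | a. True}"

locale Cstar_Frobenius_algebra =
  fixes C :: "('o, 'm, 'z) tensor_cat_scheme" (structure)
    and X :: 'o and m :: 'm and \<iota> :: 'm
  assumes X_obj: "X \<in> obj C"
    and m_hom: "m \<in> hom C (X \<boxtimes> X) X"
    and \<iota>_hom: "\<iota> \<in> hom C \<I> X"
    and associativity: "m \<cdot> (m \<otimes> \<one> X) = m \<cdot> (\<one> X \<otimes> m)"
    and unitality_left: "m \<cdot> (\<iota> \<otimes> \<one> X) = \<one> X"
    and unitality_right: "m \<cdot> (\<one> X \<otimes> \<iota>) = \<one> X"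
    and Frobenius_left: "(m \<otimes> \<one> X) \<cdot> (\<one> X \<otimes> m\<^sup>\<dagger>) = m\<^sup>\<dagger> \<cdot> m"
    and Frobenius_right: "(\<one> X \<otimes> m) \<cdot> (m\<^sup>\<dagger> \<otimes> \<one> X) = m\<^sup>\<dagger> \<cdot> m"

definition frob_ev :: "('o, 'm, 'z) tensor_cat_scheme \<Rightarrow> 'm \<Rightarrow> 'm \<Rightarrow> 'm" where
  "frob_ev C m \<iota> = \<iota>\<^sup>\<dagger>\<^bsub>C\<^esub> \<cdot>\<^bsub>C\<^esub> m"

definition frob_coev :: "('o, 'm, 'z) tensor_cat_scheme \<Rightarrow> 'm \<Rightarrow> 'm \<Rightarrow> 'm" where
  "frob_coev C m \<iota> = m\<^sup>\<dagger>\<^bsub>C\<^esub> \<cdot>\<^bsub>C\<^esub> \<iota>"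

text \<open>
  \<open>T\<close> is meant to be an endomorphism of \<open>X \<boxtimes> X\<close>. By strictness
  \<open>\<I> \<boxtimes> (X \<boxtimes> X) = X \<boxtimes> X = (X \<boxtimes> X) \<boxtimes> \<I>\<close>, so the composite is again such an endomorphism.
\<close>

definition cat_crossing ::
    "('o, 'm, 'z) tensor_cat_scheme \<Rightarrow> 'o \<Rightarrow> 'm \<Rightarrow> 'm \<Rightarrow> 'm \<Rightarrow> 'm" where
  "cat_crossing C X ev coev T =
     (\<one>\<^bsub>C\<^esub> (X \<boxtimes>\<^bsub>C\<^esub> X) \<otimes>\<^bsub>C\<^esub> ev) \<cdot>\<^bsub>C\<^esub> (\<one>\<^bsub>C\<^esub> X \<otimes>\<^bsub>C\<^esub> T \<otimes>\<^bsub>C\<^esub> \<one>\<^bsub>C\<^esub> X)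
       \<cdot>\<^bsub>C\<^esub> (coev \<otimes>\<^bsub>C\<^esub> \<one>\<^bsub>C\<^esub> (X \<boxtimes>\<^bsub>C\<^esub> X))"

definition crossing_symmetric ::
    "('o, 'm, 'z) tensor_cat_scheme \<Rightarrow> 'o \<Rightarrow> 'm \<Rightarrow> 'm \<Rightarrow> 'm \<Rightarrow> bool" where
  "crossing_symmetric C X ev coev T \<longleftrightarrow>
     T \<in> hom C (X \<boxtimes>\<^bsub>C\<^esub> X) (X \<boxtimes>\<^bsub>C\<^esub> X) \<and> cat_crossing C X ev coev T = T\<^sup>\<dagger>\<^bsub>C\<^esub>"

end

theory Submission
  imports Defs
begin

text \<open>
  By associativity of the tensor product, the crossing map of \<open>m\<^sup>\<dagger> \<cdot> m\<close> factors as
  \<open>(\<one> X \<otimes> ((\<one> X \<otimes> ev) \<cdot> (m\<^sup>\<dagger> \<otimes> \<one> X))) \<cdot> (((\<one> X \<otimes> m) \<cdot> (coev \<otimes> \<one> X)) \<otimes> \<one> X)\<close>. The Frobenius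
  property and unitality turn the inner composites into \<open>m\<close> and \<open>m\<^sup>\<dagger>\<close>, and
  \<open>(\<one> X \<otimes> m) \<cdot> (m\<^sup>\<dagger> \<otimes> \<one> X) = m\<^sup>\<dagger> \<cdot> m\<close> by the Frobenius property once more.
\<close>

context strict_Cstar_tensor_category
begin

text \<open>Interchange law, with the idle strand \<open>\<one> W\<close> written as
  \<open>\<one> W \<cdot> \<one> W\<close>.\<close>

lemma whisker_right_comp:
  assumes "f \<in> hom C X Y" "g \<in> hom C Y Z" "W \<in> obj C"
  shows "(g \<cdot> f) \<otimes> \<one> W = (g \<otimes> \<one> W) \<cdot> (f \<otimes> \<one> W)"
  using tens_comp[OF assms(1,2) id_hom id_hom] comp_id_left[OF id_hom] assms(3) by metis

lemma whisker_left_comp: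
  assumes "f \<in> hom C X Y" "g \<in> hom C Y Z" "W \<in> obj C"
  shows "\<one> W \<otimes> (g \<cdot> f) = (\<one> W \<otimes> g) \<cdot> (\<one> W \<otimes> f)"
  using tens_comp[OF id_hom id_hom assms(1,2)] comp_id_left[OF id_hom] assms(3) by metis

end

text \<open>The Frobenius locale carries only the equations of the algebra; joining it with the
  category axioms makes both available for one fixed \<open>C\<close>.\<close>

locale strict_Cstar_Frobenius_algebra =
  strict_Cstar_tensor_category C + Cstar_Frobenius_algebra C X m \<iota>
  for C :: "('o, 'm, 'z) tensor_cat_scheme" (structure) and X :: 'o and m \<iota> :: 'm
begin

lemma comult_hom: "m\<^sup>\<dagger> \<in> hom C X (X \<boxtimes> X)"
  using adj_hom[OF m_hom] .

lemma frob_ev_hom: "frob_ev C m \<iota> \<in> hom C (X \<boxtimes> X) \<I>"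
  unfolding frob_ev_def using comp_hom[OF m_hom adj_hom[OF \<iota>_hom]] .

lemma frob_coev_hom: "frob_coev C m \<iota> \<in> hom C \<I> (X \<boxtimes> X)"
  unfolding frob_coev_def using comp_hom[OF \<iota>_hom comult_hom] .

lemmas id_X_hom = id_hom[OF X_obj]

text \<open>Adjoint of right unitality.\<close>

lemma counitality_right: "(\<one> X \<otimes> \<iota>\<^sup>\<dagger>) \<cdot> m\<^sup>\<dagger> = \<one> X"
proof -
  \<comment> \<open>The right side of \<open>(\<one> X)\<^sup>\<dagger> = \<one> X \<cdot> (\<one>
    X)\<^sup>\<dagger>\<close> is self-adjoint, hence so is
    \<open>(\<one> X)\<^sup>\<dagger>\<close>, and its adjoint is \<open>\<one> X\<close>.\<close>
  have id_adj: "(\<one> X)\<^sup>\<dagger> = \<one> X"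
    by (metis adj_adj adj_comp adj_hom comp_id_left id_X_hom)
  have "\<one> X \<otimes> \<iota> \<in> hom C X (X \<boxtimes> X)"
    using tens_hom[OF id_X_hom \<iota>_hom] by (simp add: tens_obj_unit_right X_obj)
  then have "(m \<cdot> (\<one> X \<otimes> \<iota>))\<^sup>\<dagger> = (\<one> X \<otimes> \<iota>)\<^sup>\<dagger> \<cdot> m\<^sup>\<dagger>"
    by (rule adj_comp[OF _ m_hom])
  then show ?thesis
    by (simp add: unitality_right tens_adj[OF id_X_hom \<iota>_hom] id_adj)
qed

text \<open>Bending an input of \<open>m\<close> with the coevaluation:
  \<open>Frobenius_right\<close> exchanges \<open>m\<close> and its adjoint, after which
  \<open>m\<close> meets the unit and disappears.\<close>

lemma mult_comp_coev: "(\<one> X \<otimes> m) \<cdot> (frob_coev C m \<iota> \<otimes> \<one> X) = m\<^sup>\<dagger>"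
proof -
  have i: "\<iota> \<otimes> \<one> X \<in> hom C X (X \<boxtimes> X)"
    using tens_hom[OF \<iota>_hom id_X_hom] by (simp add: tens_obj_unit_left X_obj)
  have d: "m\<^sup>\<dagger> \<otimes> \<one> X \<in> hom C (X \<boxtimes> X) (X \<boxtimes> (X \<boxtimes> X))"
    using tens_hom[OF comult_hom id_X_hom] by (simp add: tens_obj_assoc X_obj)
  have mm: "\<one> X \<otimes> m \<in> hom C (X \<boxtimes> (X \<boxtimes> X)) (X \<boxtimes> X)"
    using tens_hom[OF id_X_hom m_hom] .
  have "(\<one> X \<otimes> m) \<cdot> (frob_coev C m \<iota> \<otimes> \<one> X) = ((\<one> X \<otimes> m) \<cdot> (m\<^sup>\<dagger> \<otimes> \<one> X)) \<cdot> (\<iota> \<otimes> \<one> X)"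
    unfolding frob_coev_def whisker_right_comp[OF \<iota>_hom comult_hom X_obj]
    using comp_assoc[OF i d mm] by simp
  also have "\<dots> = m\<^sup>\<dagger> \<cdot> (m \<cdot> (\<iota> \<otimes> \<one> X))"
    unfolding Frobenius_right by (rule comp_assoc[OF i m_hom comult_hom])
  also have "\<dots> = m\<^sup>\<dagger>"
    by (simp add: unitality_left comp_id_right[OF comult_hom])
  finally show ?thesis .
qed

text \<open>The same Frobenius identity, now with the counit closing an output. This is not the
  adjoint of \<open>mult_comp_coev\<close>, which would have the evaluation on the left
  strand.\<close>

lemma ev_comp_comult: "(\<one> X \<otimes> frob_ev C m \<iota>) \<cdot> (m\<^sup>\<dagger> \<otimes> \<one> X) = m"
proof -
  have e: "\<one> X \<otimes> \<iota>\<^sup>\<dagger> \<in> hom C (X \<boxtimes> X) X"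
    using tens_hom[OF id_X_hom adj_hom[OF \<iota>_hom]] by (simp add: tens_obj_unit_right X_obj)
  have d: "m\<^sup>\<dagger> \<otimes> \<one> X \<in> hom C (X \<boxtimes> X) (X \<boxtimes> (X \<boxtimes> X))"
    using tens_hom[OF comult_hom id_X_hom] by (simp add: tens_obj_assoc X_obj)
  have mm: "\<one> X \<otimes> m \<in> hom C (X \<boxtimes> (X \<boxtimes> X)) (X \<boxtimes> X)"
    using tens_hom[OF id_X_hom m_hom] .
  have "(\<one> X \<otimes> frob_ev C m \<iota>) \<cdot> (m\<^sup>\<dagger> \<otimes> \<one> X) = (\<one> X \<otimes> \<iota>\<^sup>\<dagger>) \<cdot> (m\<^sup>\<dagger> \<cdot> m)"
    unfolding frob_ev_def whisker_left_comp[OF m_hom adj_hom[OF \<iota>_hom] X_obj]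
    using comp_assoc[OF d mm e] by (simp add: Frobenius_right)
  also have "\<dots> = m"
    using comp_assoc[OF m_hom comult_hom e] by (simp add: counitality_right comp_id_left[OF m_hom])
  finally show ?thesis .
qed

lemma cat_crossing_mult:
  "cat_crossing C X (frob_ev C m \<iota>) (frob_coev C m \<iota>) (m\<^sup>\<dagger> \<cdot> m) = m\<^sup>\<dagger> \<cdot> m"
proof -
  let ?ev = "frob_ev C m \<iota>" and ?coev = "frob_coev C m \<iota>"
  note X = X_obj tens_obj[OF X_obj X_obj]
  \<comment> \<open>By strictness these are equalities of objects. Rewriting every object to its
    right-nested form makes the hom-sets below match literally, as \<open>comp_assoc\<close>
    requires.\<close>
  note assoc = tens_obj_assoc X tens_obj tens_obj_unit_left tens_obj_unit_right
  have m1: "\<one> X \<otimes> m \<in> hom C (X \<boxtimes> (X \<boxtimes> X)) (X \<boxtimes> X)"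
    using tens_hom[OF id_X_hom m_hom] .
  have d1: "\<one> X \<otimes> m\<^sup>\<dagger> \<in> hom C (X \<boxtimes> X) (X \<boxtimes> (X \<boxtimes> X))"
    using tens_hom[OF id_X_hom comult_hom] .
  have d2: "m\<^sup>\<dagger> \<otimes> \<one> X \<in> hom C (X \<boxtimes> X) (X \<boxtimes> (X \<boxtimes> X))"
    using tens_hom[OF comult_hom id_X_hom] by (simp add: assoc)
  have e1: "\<one> X \<otimes> ?ev \<in> hom C (X \<boxtimes> (X \<boxtimes> X)) X"
    using tens_hom[OF id_X_hom frob_ev_hom] by (simp add: assoc)
  have c1: "?coev \<otimes> \<one> X \<in> hom C X (X \<boxtimes> (X \<boxtimes> X))"
    using tens_hom[OF frob_coev_hom id_X_hom] by (simp add: assoc)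
  have M: "(\<one> X \<otimes> m) \<otimes> \<one> X \<in> hom C (X \<boxtimes> (X \<boxtimes> (X \<boxtimes> X))) (X \<boxtimes> (X \<boxtimes> X))"
    using tens_hom[OF m1 id_X_hom] by (simp add: assoc)
  have D: "(\<one> X \<otimes> m\<^sup>\<dagger>) \<otimes> \<one> X \<in> hom C (X \<boxtimes> (X \<boxtimes> X)) (X \<boxtimes> (X \<boxtimes> (X \<boxtimes> X)))"
    using tens_hom[OF d1 id_X_hom] by (simp add: assoc)
  have E: "\<one> (X \<boxtimes> X) \<otimes> ?ev \<in> hom C (X \<boxtimes> (X \<boxtimes> (X \<boxtimes> X))) (X \<boxtimes> X)"
    using tens_hom[OF id_hom[OF X(2)] frob_ev_hom] by (simp add: assoc)
  have K: "?coev \<otimes> \<one> (X \<boxtimes> X) \<in> hom C (X \<boxtimes> X) (X \<boxtimes> (X \<boxtimes> (X \<boxtimes> X)))"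
    using tens_hom[OF frob_coev_hom id_hom[OF X(2)]] by (simp add: assoc)
  \<comment> \<open>Regrouping exposes an idle strand: the leftmost \<open>X\<close> beside the
    evaluation, the rightmost \<open>X\<close> beside the coevaluation.\<close>
  have E_eq: "\<one> (X \<boxtimes> X) \<otimes> ?ev = \<one> X \<otimes> (\<one> X \<otimes> ?ev)"
    using tens_assoc[OF id_X_hom id_X_hom frob_ev_hom] by (simp add: tens_id X)
  have K_eq: "?coev \<otimes> \<one> (X \<boxtimes> X) = (?coev \<otimes> \<one> X) \<otimes> \<one> X"
    using tens_assoc[OF frob_coev_hom id_X_hom id_X_hom] by (simp add: tens_id X)
  \<comment> \<open>The two halves of the middle factor part ways: the comultiplication goes to the
    evaluation, the multiplication to the coevaluation.\<close>
  have split: "\<one> X \<otimes> (m\<^sup>\<dagger> \<cdot> m) \<otimes> \<one> X = ((\<one> X \<otimes> m\<^sup>\<dagger>) \<otimes> \<one> X) \<cdot> ((\<one> X \<otimes> m) \<otimes> \<one> X)"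
    unfolding whisker_left_comp[OF m_hom comult_hom X_obj]
    by (rule whisker_right_comp[OF m1 d1 X_obj])
  have left: "(\<one> (X \<boxtimes> X) \<otimes> ?ev) \<cdot> ((\<one> X \<otimes> m\<^sup>\<dagger>) \<otimes> \<one> X) = \<one> X \<otimes> m"
    unfolding E_eq tens_assoc[OF id_X_hom comult_hom id_X_hom]
    using whisker_left_comp[OF d2 e1 X_obj] by (simp add: ev_comp_comult)
  have right: "((\<one> X \<otimes> m) \<otimes> \<one> X) \<cdot> (?coev \<otimes> \<one> (X \<boxtimes> X)) = m\<^sup>\<dagger> \<otimes> \<one> X"
    unfolding K_eq using whisker_right_comp[OF c1 m1 X_obj] by (simp add: mult_comp_coev)
  have "cat_crossing C X ?ev ?coev (m\<^sup>\<dagger> \<cdot> m)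
      = ((\<one> (X \<boxtimes> X) \<otimes> ?ev) \<cdot> ((\<one> X \<otimes> m\<^sup>\<dagger>) \<otimes> \<one> X))
        \<cdot> (((\<one> X \<otimes> m) \<otimes> \<one> X) \<cdot> (?coev \<otimes> \<one> (X \<boxtimes> X)))"
    unfolding cat_crossing_def split
    \<comment> \<open>The definition unfolds to the bracketing E(DM)K; the two instances turn it
      into (ED)(MK).\<close>
    using comp_assoc[OF M D E] comp_assoc[OF K M comp_hom[OF D E]] by simp
  then show ?thesis
    by (simp add: left right Frobenius_right)
qed

end

theorem proposition6p18:
  fixes C :: "('o, 'm, 'z) tensor_cat_scheme" (structure)
    and X :: 'o and m \<iota> T ev coev :: 'm
  assumes "strict_Cstar_tensor_category C"
    and "simple_unit C"
    and "Cstar_Frobenius_algebra C X m \<iota>"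
  defines "T \<equiv> m\<^sup>\<dagger> \<cdot> m"
    and "ev \<equiv> frob_ev C m \<iota>"
    and "coev \<equiv> frob_coev C m \<iota>"
  shows "T \<in> hom C (X \<boxtimes> X) (X \<boxtimes> X) \<and>
    crossing_symmetric C X ev coev T \<and>
    cat_crossing C X ev coev T = T\<^sup>\<dagger> \<and> T\<^sup>\<dagger> = T"
proof -
  interpret strict_Cstar_Frobenius_algebra C X m \<iota>
    using assms(1,3) by (rule strict_Cstar_Frobenius_algebra.intro)
  have T_hom: "T \<in> hom C (X \<boxtimes> X) (X \<boxtimes> X)"
    unfolding T_def using comp_hom[OF m_hom comult_hom] .
  have T_adj: "T\<^sup>\<dagger> = T"
    unfolding T_def using adj_comp[OF m_hom comult_hom] by (simp add: adj_adj[OF m_hom])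
  \<comment> \<open>The crossing map returns \<open>T\<close> itself; crossing symmetry then follows
    from the self-adjointness of \<open>T\<close>.\<close>
  have "cat_crossing C X ev coev T = T"
    unfolding T_def ev_def coev_def by (rule cat_crossing_mult)
  with T_hom T_adj show ?thesis
    by (simp add: crossing_symmetric_def)
qed

end
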